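(* Let $\{\pi_n\}_{n\ge 0}$ be the monic Legendre polynomials, i.e. $\pi_0(x)=1$, $\pi_1(x)=x$ and $\pi_{n+1}(x)=x\pi_n(x)-\frac{n^2}{4n^2-1}\pi_{n-1}(x)$ for $n\ge 1$. Let $\delta\in(0,1)$ be any fixed small number. For $x$ in a small complex neighborhood of the interval $[-1+\delta,1-\delta]$, we have $$\pi_n(x)\sim\frac{1}{2^n}\left[\cos (n\theta)\left(\frac{1+\sin\theta}{\sin\theta}\right)^{1/2}+\sin (n\theta)\left(\frac{1-\sin\theta}{\sin\theta}\right)^{1/2}\right]$$ as $n\to\infty$, where $\theta=\theta(x):=\arccos x$ with $0<\mathrm{Re}\,\theta<\pi$. Precisely: there are an open set $U\subset\mathbb{C}$ containing $[-1+\delta,1-\delta]$ and functions $\varepsilon_n^{(1)},\varepsilon_n^{(2)}:U\to\mathbb{C}$ tending to $0$ uniformly on $U$ as $n\to\infty$ such that, for all $x\in U$ and all $n\ge 1$, $$\pi_n(x)=\frac{1}{2^n}\left[\left(f(x)+\varepsilon_n^{(1)}(x)\right)\cos (n\theta)+\left(g(x)+\varepsilon_n^{(2)}(x)\right)\sin (n\theta)\right],$$ where $f=\left(\frac{1+\sin\theta}{\sin\theta}\right)^{1/2}$ and $g=\left(\frac{1-\sin\theta}{\sin\theta}\right)^{1/2}$, with the branches specified in the context.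
   Context: The polynomials satisfy $\pi_n(x)=\frac{2^n n!}{(n+1)_n}P_n(x)$, where $P_n$ is the Legendre polynomial and $(a)_n=a(a+1)\cdots(a+n-1)$. On a small neighborhood of $[-1+\delta,1-\delta]$, $\theta=\arccos x$ is the analytic branch that is real with values in $(0,\pi)$ for real $x$. The square roots are the analytic branches $$\left(\frac{1+\sin\theta}{\sin\theta}\right)^{1/2}=\frac{\cos(\theta/2)+\sin(\theta/2)}{(\sin\theta)^{1/2}},\qquad \left(\frac{1-\sin\theta}{\sin\theta}\right)^{1/2}=\frac{\cos(\theta/2)-\sin(\theta/2)}{(\sin\theta)^{1/2}},$$ with $(\sin\theta)^{1/2}$ principal. (The second one is positive for $x>0$ and negative for $x<0$, $x$ real.) *)

theory Defs
  imports "HOL-Analysis.Analysis" "HOL-Computational_Algebra.Polynomial"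
begin

fun monic_legendre :: "nat \<Rightarrow> complex poly" where
  "monic_legendre 0 = 1"
| "monic_legendre (Suc 0) = [:0, 1:]"
| "monic_legendre (Suc (Suc n)) =
     [:0, 1:] * monic_legendre (Suc n)
     - smult (of_nat (Suc n) ^ 2 / (4 * of_nat (Suc n) ^ 2 - 1)) (monic_legendre n)"

lemma monic_legendre_rec:
  assumes "n \<ge> 1"
  shows "poly (monic_legendre (n + 1)) x =
    x * poly (monic_legendre n) x
    - of_nat n ^ 2 / (4 * of_nat n ^ 2 - 1) * poly (monic_legendre (n - 1)) x"
  using assms by (cases n) simp_all

text \<open>
  The amplitudes are the analytic branches of the square roots of \<open>(1 + sin \<theta>) / sin \<theta>\<close> and
  \<open>(1 - sin \<theta>) / sin \<theta>\<close> with \<open>\<theta> = Arccos x\<close>, written with half angles: the second one changes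
  sign at \<open>x = 0\<close>, so \<^const>\<open>csqrt\<close> of the quotient would be the wrong branch. Where
  \<open>0 < Re \<theta> < pi\<close>, \<open>sin \<theta>\<close> has positive real part and \<open>csqrt (sin \<theta>)\<close> is analytic.
\<close>

definition amp_cos :: "complex \<Rightarrow> complex" where
  "amp_cos x = (cos (Arccos x / 2) + sin (Arccos x / 2)) / csqrt (sin (Arccos x))"

definition amp_sin :: "complex \<Rightarrow> complex" where
  "amp_sin x = (cos (Arccos x / 2) - sin (Arccos x / 2)) / csqrt (sin (Arccos x))"

lemma amp_cos_squared: "amp_cos x ^ 2 = (1 + sin (Arccos x)) / sin (Arccos x)"
proof -
  have "(cos (t / 2) + sin (t / 2)) ^ 2 = 1 + sin t" for t :: complex
    using sin_cos_squared_add[of "t / 2"] sin_double[of "t / 2"]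
    by (simp add: power2_sum algebra_simps)
  then show ?thesis by (simp add: amp_cos_def power_divide)
qed

lemma amp_sin_squared: "amp_sin x ^ 2 = (1 - sin (Arccos x)) / sin (Arccos x)"
proof -
  have "(cos (t / 2) - sin (t / 2)) ^ 2 = 1 - sin t" for t :: complex
    using sin_cos_squared_add[of "t / 2"] sin_double[of "t / 2"]
    by (simp add: power2_diff algebra_simps)
  then show ?thesis by (simp add: amp_sin_def power_divide)
qed

end

theory Submission
  imports Defs
begin

text \<open>
  Write \<open>x = cos \<theta>\<close>, \<open>w = exp (\<i> \<theta>)\<close> and \<open>u = w\<^sup>2\<close>. The generating function of the Legendre
  polynomials factors as \<open>(1 - w t) powr (-1/2) * (1 - t / w) powr (-1/2)\<close>. With \<open>c\<^sub>k\<close> the coefficients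
  of \<open>(1 - z) powr (-1/2)\<close>, it follows that \<open>2 ^ n * \<pi>\<^sub>n(x) * w ^ n\<close> is the polynomial
  \<open>Q\<^sub>n(u) = \<Sum>k\<le>n. d\<^sub>n\<^sub>k u ^ k\<close> with \<open>d\<^sub>n\<^sub>k = c\<^sub>k c\<^sub>n\<^sub>-\<^sub>k / c\<^sub>n\<close> (\<open>monic_legendre_eq_legQ\<close>). The same holds
  for \<open>w = exp (- \<i> \<theta>)\<close>, so one may choose the sign that gives \<open>norm u \<le> 1\<close>.

  The coefficients \<open>d\<^sub>n\<^sub>k\<close> are symmetric under \<open>k \<mapsto> n - k\<close> and, for fixed \<open>k\<close>, tend to \<open>c\<^sub>k\<close>. Hence the lower
  half of \<open>Q\<^sub>n\<close> should approach \<open>(1 - u) powr (-1/2)\<close>, and the upper half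
  \<open>u ^ n * (1 - 1/u) powr (-1/2)\<close>. These series do not converge absolutely on the unit circle, so
  each half is first multiplied by \<open>1 - z\<close>, where \<open>z\<close> is \<open>u\<close> or \<open>1/u\<close>. Summation by parts turns the
  coefficients into the differences \<open>d\<^sub>n\<^sub>k - d\<^sub>n\<^sub>,\<^sub>k\<^sub>-\<^sub>1\<close>, to be compared with the coefficients
  \<open>b\<^sub>k = c\<^sub>k - c\<^sub>k\<^sub>-\<^sub>1\<close> of \<open>(1 - z) powr (1/2)\<close>, which are absolutely summable. The comparison is
  one-sided: \<open>d\<^sub>n\<^sub>k - d\<^sub>n\<^sub>,\<^sub>k\<^sub>-\<^sub>1 \<ge> b\<^sub>k\<close> (\<open>cdiff_le_lcoef_diff\<close>). So the total error telescopes to at most the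
  middle coefficient, which is \<open>O(1 / sqrt n)\<close> (\<open>half_sum\<close>, \<open>lcoef_middle\<close>).

  In the upper half the series in \<open>1/u\<close> diverges when \<open>norm u < 1\<close>, but there the factor \<open>u ^ n\<close> is
  small. A compactness argument along rays from the unit circle outward (\<open>radial_bound\<close>) covers the
  transition between the two regimes, and gives the uniform limit \<open>legQ_uniform_limit\<close>.

  Finally \<open>amp_cos x \<plusminus> \<i> * amp_sin x = 2 / csqrt (1 - exp (\<plusminus> 2 \<i> \<theta>))\<close> identifies both limits with the
  amplitudes of the statement. The error is charged entirely to the dominant one of the two exponentials
  \<open>exp (\<plusminus> \<i> n \<theta>)\<close>, since off the real axis an error measured relative to the recessive one could not be
  bounded; writing that exponential as \<open>cos (n \<theta>) \<plusminus> \<i> sin (n \<theta>)\<close> splits it into the two error functions.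
\<close>

section \<open>The coefficients of \<open>(1 - z) powr (-1/2)\<close> and \<open>(1 - z) powr (1/2)\<close>\<close>

text \<open>
  The number \<open>(2 k choose k) / 4 ^ k\<close>, the coefficient of \<open>z ^ k\<close> in \<open>(1 - z) powr (-1/2)\<close>.
\<close>

primrec cbin :: "nat \<Rightarrow> real" where
  "cbin 0 = 1"
| "cbin (Suc k) = cbin k * ((2 * real k + 1) / (2 * real k + 2))"

text \<open>
  Multiplying by \<open>1 - z\<close> takes differences of coefficients, so these are the coefficients of
  \<open>(1 - z) powr (1/2)\<close>.
\<close>

primrec cdiff :: "nat \<Rightarrow> real" where
  "cdiff 0 = 1"
| "cdiff (Suc k) = cbin (Suc k) - cbin k"

lemma cbin_pos: "0 < cbin k"
  by (induction k) auto

lemma cbin_Suc_le: "cbin (Suc k) \<le> cbin k"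
proof -
  have "cbin k * ((2 * real k + 1) / (2 * real k + 2)) \<le> cbin k * 1"
    using cbin_pos[of k] by (intro mult_left_mono) auto
  then show ?thesis by simp
qed

lemma cbin_antimono: "j \<le> k \<Longrightarrow> cbin k \<le> cbin j"
  using decseqD[OF decseq_SucI[of cbin, OF cbin_Suc_le]] .

lemma cdiff_Suc_eq: "cdiff (Suc k) = - cbin k / (2 * real k + 2)"
  by (simp add: field_simps)

lemma abs_cdiff_Suc: "\<bar>cdiff (Suc k)\<bar> = cbin k - cbin (Suc k)"
  using cbin_Suc_le[of k] by simp

text \<open>
  This and the next bound reflect \<open>c\<^sub>k \<approx> 1 / sqrt (\<pi> k)\<close>: the quantities \<open>c\<^sub>k\<^sup>2 (2 k + 1)\<close> and \<open>4 k c\<^sub>k\<^sup>2\<close> are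
  monotone in \<open>k\<close>, decreasing and increasing respectively.
\<close>

lemma cbin_sq_upper: "(cbin k)\<^sup>2 * (2 * real k + 1) \<le> 1"
proof (induction k)
  case (Suc k)
  have "(cbin (Suc k))\<^sup>2 * (2 * real (Suc k) + 1)
      = ((cbin k)\<^sup>2 * (2 * real k + 1)) * ((2 * real k + 1) * (2 * real k + 3) / (2 * real k + 2)\<^sup>2)"
    by (simp add: power2_eq_square field_simps)
  also have "\<dots> \<le> 1 * 1"
    using Suc by (intro mult_mono) (simp_all add: power2_eq_square divide_simps add_nonneg_nonneg not_less, simp_all add: algebra_simps)
  finally show ?case by simp
qed simp

lemma cbin_sq_lower: "1 \<le> (cbin (Suc k))\<^sup>2 * (4 * real (Suc k))"
proof (induction k)
  case (Suc k)
  have "1 * 1 \<le> ((cbin (Suc k))\<^sup>2 * (4 * real (Suc k)))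
      * ((2 * real (Suc k) + 1)\<^sup>2 / ((2 * real (Suc k)) * (2 * real (Suc k) + 2)))"
    using Suc by (intro mult_mono) (simp_all del: cbin.simps of_nat_Suc add: power2_eq_square divide_simps, simp_all add: algebra_simps del: cbin.simps)
  also have "\<dots> = (cbin (Suc (Suc k)))\<^sup>2 * (4 * real (Suc (Suc k)))"
    unfolding cbin.simps(2)[of "Suc k"]
    by (simp del: cbin.simps add: power2_eq_square divide_simps) (simp add: algebra_simps del: cbin.simps)
  finally show ?case by simp
qed (simp add: power2_eq_square)

lemma cbin_tendsto_0: "cbin \<longlonglongrightarrow> 0"
proof (rule tendsto_sandwich)
  show "\<forall>\<^sub>F k in sequentially. 0 \<le> cbin k"
    using cbin_pos by (auto intro!: always_eventually less_imp_le)
  have "cbin k \<le> sqrt (1 / (2 * real k + 1))" for k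
    using cbin_sq_upper[of k] by (intro real_le_rsqrt) (auto simp: field_simps)
  then show "\<forall>\<^sub>F k in sequentially. cbin k \<le> sqrt (1 / (2 * real k + 1))" by simp
  have "(\<lambda>k. 1 / (2 * real k + 1)) \<longlonglongrightarrow> 0"
    using LIMSEQ_subseq_LIMSEQ[OF LIMSEQ_inverse_real_of_nat, of "\<lambda>k. 2 * k"]
    by (simp add: strict_mono_def o_def inverse_eq_divide add.commute)
  from tendsto_real_sqrt[OF this] show "(\<lambda>k. sqrt (1 / (2 * real k + 1))) \<longlonglongrightarrow> 0" by simp
qed simp_all

text \<open>
  The coefficients are negative from index 1 on, so the sum of their absolute values telescopes.
\<close>

lemma sum_abs_cdiff:
  assumes "J \<le> m"
  shows "(\<Sum>k\<in>{J<..m}. \<bar>cdiff k\<bar>) = cbin J - cbin m"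
  using assms
proof (induction m rule: dec_induct)
  case (step m)
  have "{J<..Suc m} = insert (Suc m) {J<..m}" using step by auto
  then show ?case using step abs_cdiff_Suc[of m] by simp
qed simp

lemma summable_abs_cdiff: "summable (\<lambda>k. \<bar>cdiff k\<bar>)"
proof (rule bounded_imp_summable)
  show "(\<Sum>k\<le>m. \<bar>cdiff k\<bar>) \<le> 2" for m
  proof -
    have "{..m} = insert 0 {0<..m}" by auto
    then have "(\<Sum>k\<le>m. \<bar>cdiff k\<bar>) = 1 + (\<Sum>k\<in>{0<..m}. \<bar>cdiff k\<bar>)" by simp
    then show ?thesis using sum_abs_cdiff[of 0 m] cbin_pos[of m] by simp
  qed
qed simp

lemma cdiff_gbinomial: "complex_of_real (cdiff k) = (-1) ^ k * ((1/2) gchoose k)"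
proof (induction k)
  case (Suc k)
  have "complex_of_real (cdiff (Suc k)) = complex_of_real (cdiff k) * ((of_nat k - 1/2) / (of_nat k + 1))"
  proof (cases k)
    case (Suc j)
    have "cdiff (Suc (Suc j)) = cdiff (Suc j) * ((real (Suc j) - 1/2) / (real (Suc j) + 1))"
      unfolding cdiff_Suc_eq by (simp add: divide_simps)
    then have "complex_of_real (cdiff (Suc (Suc j)))
       = of_real (cdiff (Suc j) * ((real (Suc j) - 1/2) / (real (Suc j) + 1)))" by (simp only:)
    then show ?thesis using Suc by (simp del: cdiff.simps)
  qed simp
  also have "\<dots> = (-1) ^ Suc k * ((1/2) gchoose Suc k)"
  proof -
    have "of_nat (Suc k) * (((1/2)::complex) gchoose Suc k) = (1/2 - of_nat k) * (1/2 gchoose k)"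
      by (metis gbinomial_absorb_comp gbinomial_absorption)
    then have "(((1/2)::complex) gchoose Suc k) = (1/2 - of_nat k) * (1/2 gchoose k) / of_nat (Suc k)"
      by (simp add: field_simps del: of_nat_Suc)
    then show ?thesis using Suc by (simp add: field_simps del: cdiff.simps)
  qed
  finally show ?case .
qed simp

text \<open>
  Inside the disc this is the binomial series. It extends to the boundary because the series converges
  uniformly on the closed disc, and \<open>csqrt (1 - z)\<close> is continuous there except at \<open>z = 1\<close>, so that both
  sides have the same radial limit.
\<close>

lemma cdiff_sums:
  assumes "norm z \<le> 1" "z \<noteq> 1"
  shows "(\<lambda>k. of_real (cdiff k) * z ^ k) sums csqrt (1 - z)"
proof -
  define f where "f = (\<lambda>z::complex. \<Sum>k. of_real (cdiff k) * z ^ k)"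
  have M: "norm (of_real (cdiff k) * y ^ k) \<le> \<bar>cdiff k\<bar>" if "y \<in> cball 0 1" for k and y :: complex
    using that by (simp add: norm_mult norm_power mult_left_le power_le_one)
  have sm: "(\<lambda>k. of_real (cdiff k) * y ^ k) sums f y" if "norm y \<le> 1" for y
  proof -
    have "summable (\<lambda>k. of_real (cdiff k) * y ^ k)"
      using M[of y] that by (intro summable_comparison_test'[OF summable_abs_cdiff, of 0]) simp
    then show ?thesis unfolding f_def by (rule summable_sums)
  qed
  have "uniform_limit (cball 0 1) (\<lambda>n y. \<Sum>k<n. of_real (cdiff k) * y ^ k) f sequentially"
    unfolding f_def by (rule Weierstrass_m_test[OF M summable_abs_cdiff])
  then have cont: "continuous_on (cball 0 1) f"
    by (rule uniform_limit_theorem[rotated]) (auto intro!: always_eventually continuous_intros)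
  have inside: "f y = csqrt (1 - y)" if "norm y < 1" for y
  proof -
    have "(\<lambda>k. ((1/2) gchoose k) * (- y) ^ k) sums (1 + - y) powr (1/2)"
      by (rule gen_binomial_complex) (use that in simp)
    moreover have "((1/2) gchoose k) * (- y) ^ k = of_real (cdiff k) * y ^ k" for k
      using power_minus[of y k] by (simp add: cdiff_gbinomial)
    moreover have "1 - y \<noteq> 0" using that by auto
    ultimately have "(\<lambda>k. of_real (cdiff k) * y ^ k) sums csqrt (1 - y)"
      by (simp add: csqrt_conv_powr)
    then show ?thesis using sm[of y] that sums_unique2 by auto
  qed
  have 1: "((\<lambda>r. f (of_real r * z)) \<longlongrightarrow> f (of_real 1 * z)) (at_left 1)"
  proof -
    have "continuous_on {0..1} (\<lambda>r. f (of_real r * z))"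
      using assms
      by (intro continuous_on_compose2[OF cont] continuous_intros)
        (auto simp: norm_mult intro!: mult_le_one)
    then show ?thesis by (rule continuous_on_Icc_at_leftD) simp
  qed
  have 2: "((\<lambda>r. csqrt (1 - of_real r * z)) \<longlongrightarrow> csqrt (1 - of_real 1 * z)) (at_left 1)"
  proof -
    have "1 - z \<notin> \<real>\<^sub>\<le>\<^sub>0"
    proof
      assume "1 - z \<in> \<real>\<^sub>\<le>\<^sub>0"
      then have "Im z = 0" "1 \<le> Re z" by (auto simp: complex_nonpos_Reals_iff)
      moreover have "Re z \<le> 1" using assms complex_Re_le_cmod[of z] by linarith
      ultimately show False using assms by (auto simp: complex_eq_iff)
    qed
    then have "isCont csqrt (1 - of_real 1 * z)" by (intro continuous_at_csqrt) simp
    then show ?thesis by (rule isCont_tendsto_compose) (intro tendsto_intros)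
  qed
  have 3: "\<forall>\<^sub>F r in at_left 1. csqrt (1 - of_real r * z) = f (of_real r * z)"
  proof -
    have "\<forall>\<^sub>F r in at_left 1. r \<in> {0<..<1::real}" by (rule eventually_at_left_real) simp
    then show ?thesis
    proof eventually_elim
      case (elim r)
      have "r * norm z \<le> r * 1" using elim assms by (intro mult_left_mono) auto
      then have "r * norm z < 1" using elim unfolding greaterThanLessThan_iff by linarith
      then have "norm (of_real r * z) < 1" using elim by (simp add: norm_mult)
      then show ?case by (simp add: inside)
    qed
  qed
  have "f (of_real 1 * z) = csqrt (1 - of_real 1 * z)"
    by (rule tendsto_unique[OF trivial_limit_at_left_real 1 Lim_transform_eventually[OF 2 3]])
  then have "f z = csqrt (1 - z)" by simp
  then show ?thesis using sm[of z] assms by simp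
qed

lemma cdiff_remainder:
  assumes "norm z \<le> 1" "z \<noteq> 1"
  shows "norm ((\<Sum>k\<le>J. of_real (cdiff k) * z ^ k) - csqrt (1 - z)) \<le> cbin J"
proof (rule tendsto_upperbound)
  let ?P = "\<lambda>m. \<Sum>k\<le>m. of_real (cdiff k) * z ^ k"
  show "(\<lambda>m. norm (?P J - ?P m)) \<longlonglongrightarrow> norm (?P J - csqrt (1 - z))"
    using cdiff_sums[OF assms] by (intro tendsto_intros) (simp add: sums_def_le)
  have "norm (?P J - ?P m) \<le> cbin J" if "J \<le> m" for m
  proof -
    have "{..m} = {..J} \<union> {J<..m}" using that by auto
    then have "?P m = ?P J + (\<Sum>k\<in>{J<..m}. of_real (cdiff k) * z ^ k)"
      by (simp only: ) (subst sum.union_disjoint, auto)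
    then have "norm (?P J - ?P m) = norm (\<Sum>k\<in>{J<..m}. of_real (cdiff k) * z ^ k)" by simp
    also have "\<dots> \<le> (\<Sum>k\<in>{J<..m}. \<bar>cdiff k\<bar>)"
      using assms by (intro sum_norm_le) (simp add: norm_mult norm_power mult_left_le power_le_one)
    also have "\<dots> \<le> cbin J" using sum_abs_cdiff[OF that] cbin_pos[of m] by simp
    finally show ?thesis .
  qed
  then show "\<forall>\<^sub>F m in sequentially. norm (?P J - ?P m) \<le> cbin J"
    by (auto simp: eventually_sequentially)
qed simp

section \<open>The Legendre polynomials as polynomials in \<open>exp (2 \<i> \<theta>)\<close>\<close>

text \<open>
  The normalisation makes the constant coefficient 1; it corresponds to that of the monic polynomials,
  as \<open>P\<^sub>n\<close> has the leading coefficient \<open>2 ^ n c\<^sub>n\<close>.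
\<close>

definition lcoef :: "nat \<Rightarrow> nat \<Rightarrow> real" where
  "lcoef n k = cbin k * cbin (n - k) / cbin n"

definition legQ :: "nat \<Rightarrow> complex \<Rightarrow> complex" where
  "legQ n u = (\<Sum>k\<le>n. of_real (lcoef n k) * u ^ k)"

text \<open>
  This is the three-term recurrence \<open>(n + 2) P\<^sub>n\<^sub>+\<^sub>2 = (2 n + 3) x P\<^sub>n\<^sub>+\<^sub>1 - (n + 1) P\<^sub>n\<close> in the variable \<open>u\<close>. The
  numbers \<open>c\<^sub>n Q\<^sub>n(u)\<close> are the coefficients of \<open>A(t) A(u t)\<close> with \<open>A(t) = (1 - t) powr (-1/2)\<close>. The differential
  equation \<open>2 (1 - t) A' = A\<close> gives one for the product, and comparing coefficients gives the recurrence.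
\<close>

lemma legQ_recurrence:
  "2 * of_nat (n + 2) * (of_real (cbin (n + 2)) * legQ (n + 2) u)
   = (1 + u) * of_nat (2 * n + 3) * (of_real (cbin (n + 1)) * legQ (n + 1) u)
     - 2 * u * of_nat (n + 1) * (of_real (cbin n) * legQ n u)"
proof -
  define A B where "A = Abs_fps (\<lambda>k. complex_of_real (cbin k))"
    and "B = Abs_fps (\<lambda>k. of_real (cbin k) * u ^ k)"
  define L where "L = B * A"
  have L: "fps_nth L n = of_real (cbin n) * legQ n u" for n
    using cbin_pos[of n]
    by (auto simp: L_def A_def B_def fps_mult_nth legQ_def lcoef_def sum_distrib_left atLeast0AtMost
        intro!: sum.cong)
  have step: "2 * of_nat (Suc k) * complex_of_real (cbin (Suc k)) = (2 * of_nat k + 1) * of_real (cbin k)" for k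
  proof -
    have "2 * real (Suc k) * cbin (Suc k) = (2 * real k + 1) * cbin k" by (simp add: field_simps)
    then have "complex_of_real (2 * real (Suc k) * cbin (Suc k)) = of_real ((2 * real k + 1) * cbin k)"
      by (simp only:)
    then show ?thesis by (simp del: cbin.simps of_nat_Suc)
  qed
  have A: "2 * (1 - fps_X) * fps_deriv A = A"
  proof (rule fps_ext)
    fix k
    show "fps_nth (2 * (1 - fps_X) * fps_deriv A) k = fps_nth A k"
      using step[of k]
      by (cases k) (simp_all add: A_def fps_numeral_fps_const mult.assoc left_diff_distrib algebra_simps del: cbin.simps)
  qed
  have B: "2 * (1 - fps_const u * fps_X) * fps_deriv B = fps_const u * B"
  proof (rule fps_ext)
    fix k
    show "fps_nth (2 * (1 - fps_const u * fps_X) * fps_deriv B) k = fps_nth (fps_const u * B) k"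
      using arg_cong[OF step[of k], of "\<lambda>c. c * u ^ Suc k"]
      by (cases k) (simp_all add: B_def fps_numeral_fps_const mult.assoc left_diff_distrib algebra_simps del: cbin.simps)
  qed
  have "2 * (1 - fps_X) * (1 - fps_const u * fps_X) * fps_deriv L
      = (1 - fps_const u * fps_X) * B * (2 * (1 - fps_X) * fps_deriv A)
        + (1 - fps_X) * A * (2 * (1 - fps_const u * fps_X) * fps_deriv B)"
    by (simp add: L_def algebra_simps)
  also have "\<dots> = (1 - fps_const u * fps_X) * L + fps_const u * (1 - fps_X) * L"
    unfolding A B by (simp add: L_def algebra_simps)
  finally have "2 * (1 - fps_X) * (1 - fps_const u * fps_X) * fps_deriv L
      = (1 - fps_const u * fps_X) * L + fps_const u * (1 - fps_X) * L" .
  then have "fps_nth (2 * (1 - fps_X) * (1 - fps_const u * fps_X) * fps_deriv L) (Suc n)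
      = fps_nth ((1 - fps_const u * fps_X) * L + fps_const u * (1 - fps_X) * L) (Suc n)"
    by (simp only:)
  then have "2 * of_nat (n + 2) * fps_nth L (n + 2) = (1 + u) * of_nat (2 * n + 3) * fps_nth L (n + 1)
     - 2 * u * of_nat (n + 1) * fps_nth L n"
    by (cases n) (simp_all add: fps_numeral_fps_const mult.assoc left_diff_distrib algebra_simps)
  then show ?thesis by (simp only: L)
qed

text \<open>
  Both sides have the same two initial values. For the recurrences to agree, the ratios of successive \<open>c\<^sub>n\<close>
  must turn the factor \<open>(n + 1)\<^sup>2 / (4 (n + 1)\<^sup>2 - 1)\<close> of the monic normalisation into the one of \<open>P\<^sub>n\<close>.
\<close>

lemma monic_legendre_eq_legQ:
  assumes w: "w \<noteq> 0" and x: "2 * x = w + 1 / w"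
  shows "2 ^ n * poly (monic_legendre n) x * w ^ n = legQ n (w\<^sup>2)"
proof (induction n rule: monic_legendre.induct)
  case 1
  show ?case by (simp add: legQ_def lcoef_def)
next
  case 2
  have "2 * x * w = (w + 1 / w) * w" by (simp only: x)
  also have "\<dots> = 1 + w\<^sup>2" using w by (simp add: field_simps power2_eq_square)
  finally have "2 * x * w = 1 + w\<^sup>2" .
  then show ?case by (simp add: legQ_def lcoef_def)
next
  case (3 n)
  define c0 c1 c2 where "c0 = complex_of_real (cbin n)" and "c1 = complex_of_real (cbin (n + 1))"
    and "c2 = complex_of_real (cbin (n + 2))"
  define N where "N = (of_nat n :: complex)"
  have c0: "c0 \<noteq> 0" using cbin_pos[of n] by (simp add: c0_def)
  have nz: "2 * N + 1 \<noteq> 0" "2 * N + 2 \<noteq> 0" "2 * N + 3 \<noteq> 0" "2 * N + 4 \<noteq> 0"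
    using of_nat_neq_0[of "2 * n", where ?'a = complex] of_nat_neq_0[of "2 * n + 1", where ?'a = complex]
      of_nat_neq_0[of "2 * n + 2", where ?'a = complex] of_nat_neq_0[of "2 * n + 3", where ?'a = complex]
    by (simp_all add: N_def add_ac)
  have c1: "c1 = c0 * ((2 * N + 1) / (2 * N + 2))" by (simp add: c0_def c1_def N_def)
  have c2: "c2 = c1 * ((2 * N + 3) / (2 * N + 4))"
    by (simp add: c1_def c2_def N_def algebra_simps)
  define p0 p1 where "p0 = poly (monic_legendre n) x" and "p1 = poly (monic_legendre (Suc n)) x"
  have "2 * x * w = (w + 1 / w) * w" by (simp only: x)
  also have "\<dots> = 1 + w\<^sup>2" using w by (simp add: field_simps power2_eq_square)
  finally have x': "2 * x * w = 1 + w\<^sup>2" .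
  have "c2 * legQ (n + 2) (w\<^sup>2) = ((1 + w\<^sup>2) * (2 * N + 3) * (c1 * legQ (n + 1) (w\<^sup>2))
     - 2 * w\<^sup>2 * (N + 1) * (c0 * legQ n (w\<^sup>2))) / (2 * N + 4)"
  proof -
    have "2 * of_nat (n + 2) = 2 * N + 4" "of_nat (2 * n + 3) = 2 * N + 3" "of_nat (n + 1) = N + 1"
      by (simp_all add: N_def)
    with legQ_recurrence[of n "w\<^sup>2"] show ?thesis
      using nz(4) unfolding c0_def c1_def c2_def by (simp only: eq_divide_eq) (simp only: mult_ac if_True not_False_eq_True)
  qed
  also have "\<dots> = (2 * x * w * (2 * N + 3) * (c1 * (2 ^ Suc n * p1 * w ^ Suc n))
     - 2 * w\<^sup>2 * (N + 1) * (c0 * (2 ^ n * p0 * w ^ n))) / (2 * N + 4)"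
    using 3 by (simp add: p0_def p1_def x')
  also have "\<dots> = c2 * (2 ^ (n + 2) * (x * p1 - (N + 1)\<^sup>2 / (4 * (N + 1)\<^sup>2 - 1) * p0) * w ^ (n + 2))"
  proof -
    define r where "r = (N + 1)\<^sup>2 / (4 * (N + 1)\<^sup>2 - 1)"
    have "4 * (N + 1)\<^sup>2 - 1 = (2 * N + 1) * (2 * N + 3)" by (simp add: power2_eq_square algebra_simps)
    then have r: "r * ((2 * N + 1) * (2 * N + 3)) = (N + 1)\<^sup>2" using nz by (simp add: r_def)
    have k1: "c1 * (2 * N + 3) = c2 * (2 * N + 4)" using nz by (simp add: c2)
    have k0: "c0 * (2 * N + 1) = c1 * (2 * N + 2)" using nz by (simp add: c1)
    have "2 * (N + 1) * (c0 * (N + 1)) = 2 * c0 * (r * ((2 * N + 1) * (2 * N + 3)))"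
      unfolding r by (simp add: power2_eq_square)
    also have "\<dots> = 2 * r * (c0 * (2 * N + 1)) * (2 * N + 3)" by (simp only: mult_ac)
    also have "\<dots> = 2 * (N + 1) * (2 * r * (c1 * (2 * N + 3)))"
      unfolding k0 by (simp add: algebra_simps)
    also have "\<dots> = 2 * (N + 1) * (2 * r * (c2 * (2 * N + 4)))" unfolding k1 ..
    finally have k2: "c0 * (N + 1) = 2 * r * (c2 * (2 * N + 4))" using nz(2) by simp
    have "2 * x * w * (2 * N + 3) * (c1 * (2 ^ Suc n * p1 * w ^ Suc n))
        - 2 * w\<^sup>2 * (N + 1) * (c0 * (2 ^ n * p0 * w ^ n))
      = (c1 * (2 * N + 3)) * (4 * 2 ^ n * x * p1 * w ^ n * w\<^sup>2)
        - (c0 * (N + 1)) * (2 * 2 ^ n * w ^ n * w\<^sup>2 * p0)"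
      by (simp add: power2_eq_square algebra_simps)
    also have "\<dots> = c2 * (2 ^ (n + 2) * (x * p1 - r * p0) * w ^ (n + 2)) * (2 * N + 4)"
      unfolding k1 k2 by (simp add: power2_eq_square algebra_simps)
    finally show ?thesis using nz(4) unfolding r_def[symmetric]
      by (simp only: nonzero_mult_div_cancel_right[OF nz(4)])
  qed
  also have "x * p1 - (N + 1)\<^sup>2 / (4 * (N + 1)\<^sup>2 - 1) * p0 = poly (monic_legendre (Suc (Suc n))) x"
    by (simp add: p0_def p1_def N_def add.commute)
  finally show ?case using c0 nz by (simp add: c1 c2)
qed

section \<open>Comparison of the two sequences of coefficient differences\<close>

text \<open>
  Each factor of the ratio \<open>c\<^sub>N\<^sub>+\<^sub>j / c\<^sub>N\<close> is at least \<open>1 - 1 / (2 N + 2)\<close>, and a product of numbers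
  \<open>1 - q\<^sub>i\<close> in the unit interval is at least \<open>1 - \<Sum>q\<^sub>i\<close>.
\<close>

lemma cbin_ratio_lower: "cbin N * (1 - real j / (2 * real N + 2)) \<le> cbin (N + j)"
proof (induction j)
  case (Suc j)
  define q where "q = 1 / (2 * real (N + j) + 2)"
  have q: "0 \<le> q" "q \<le> 1" "q \<le> 1 / (2 * real N + 2)" by (auto simp: q_def field_simps)
  define b where "b = real j / (2 * real N + 2)"
  have b: "0 \<le> b" by (simp add: b_def)
  have "real (Suc j) / (2 * real N + 2) = b + 1 / (2 * real N + 2)"
    by (simp add: b_def add_divide_distrib)
  then have "1 - real (Suc j) / (2 * real N + 2) \<le> 1 - b - q" using q by simp
  also have "\<dots> \<le> (1 - b) * (1 - q)" using q b by (simp add: algebra_simps)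
  finally have "cbin N * (1 - real (Suc j) / (2 * real N + 2)) \<le> cbin N * (1 - b) * (1 - q)"
    using cbin_pos[of N] by (simp add: mult_left_mono mult.assoc)
  also have "\<dots> \<le> cbin (N + j) * (1 - q)"
    using Suc q by (intro mult_right_mono) (auto simp: b_def)
  also have "\<dots> = cbin (N + Suc j)" by (simp add: q_def field_simps)
  finally show ?case .
qed simp

lemma lcoef_0: "lcoef n 0 = 1"
  using cbin_pos[of n] by (simp add: lcoef_def)

lemma lcoef_sym: "k \<le> n \<Longrightarrow> lcoef n (n - k) = lcoef n k"
  by (simp add: lcoef_def)

lemma lcoef_pos: "0 < lcoef n k"
  using cbin_pos by (simp add: lcoef_def)

text \<open>
  The key inequality. With \<open>N = n - k - 1\<close>, clearing the common factor \<open>c\<^sub>k / (2 k + 2)\<close> reduces it to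
  \<open>c\<^sub>N * (1 - (k + 1) / (N + 1)) \<le> c\<^sub>n\<close>, which \<open>cbin_ratio_lower\<close> gives with a factor 2 to spare. Because
  the difference of the two sides has a constant sign, the sum of its absolute values telescopes.
\<close>

lemma cdiff_le_lcoef_diff:
  assumes "Suc k \<le> n"
  shows "cdiff (Suc k) \<le> lcoef n (Suc k) - lcoef n k"
proof -
  obtain N where n: "n = N + Suc k" using assms by (metis add.commute le_Suc_ex)
  define K M where "K = 2 * real k + 2" and "M = 2 * real N + 2"
  have KM: "0 < K" "0 < M" by (auto simp: K_def M_def)
  have ck: "cbin (Suc k) = cbin k * (1 - 1 / K)" and cN: "cbin (Suc N) = cbin N * (1 - 1 / M)"
    by (simp_all add: K_def M_def field_simps)
  have "cbin N * (1 - K / M) \<le> cbin N * (1 - real (Suc k) / M)"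
    using KM cbin_pos[of N] by (intro mult_left_mono diff_mono divide_right_mono) (auto simp: K_def)
  also have "\<dots> \<le> cbin n"
    using cbin_ratio_lower[of N "Suc k"] by (simp add: n M_def)
  finally have "cbin N * (1 - K / M) \<le> cbin n" .
  then have "cbin k / K * (cbin N * (1 - K / M)) \<le> cbin k / K * cbin n"
    using KM cbin_pos[of k] by (intro mult_left_mono) auto
  then have "- cbin k / K * cbin n \<le> cbin (Suc k) * cbin N - cbin k * cbin (Suc N)"
  proof -
    have "cbin k / K * (cbin N * (1 - K / M)) = cbin k * cbin N * (1 / K - 1 / M)"
      using KM by (simp add: field_simps)
    moreover have "cbin k * (1 - 1 / K) * cbin N - cbin k * (cbin N * (1 - 1 / M))
        = - (cbin k * cbin N * (1 / K - 1 / M))" by (simp add: algebra_simps)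
    ultimately show ?thesis
      unfolding ck cN using \<open>cbin k / K * (cbin N * (1 - K / M)) \<le> cbin k / K * cbin n\<close> by linarith
  qed
  then have "- cbin k / K \<le> (cbin (Suc k) * cbin N - cbin k * cbin (Suc N)) / cbin n"
    using cbin_pos[of n] by (subst pos_le_divide_eq) auto
  also have "\<dots> = lcoef n (Suc k) - lcoef n k"
    by (simp add: lcoef_def n diff_divide_distrib Suc_diff_le del: cbin.simps)
  finally show ?thesis by (simp only: cdiff_Suc_eq K_def)
qed

text \<open>
  In the middle both \<open>c\<^sub>m\<close> and \<open>c\<^sub>n\<^sub>-\<^sub>m\<close> have size \<open>1 / sqrt n\<close>, against one such factor in the denominator. The
  range of \<open>m\<close> contains both \<open>n div 2\<close> and \<open>(n - 1) div 2\<close>.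
\<close>

lemma lcoef_middle:
  assumes "n \<ge> 1" "2 * m \<le> n" "n \<le> 2 * m + 2"
  shows "lcoef n m \<le> sqrt (8 / real n)"
proof (rule real_le_rsqrt)
  have a: "(cbin m)\<^sup>2 \<le> 2 / real n"
  proof -
    have "(cbin m)\<^sup>2 \<le> 1 / (2 * real m + 1)" using cbin_sq_upper[of m] by (simp add: field_simps)
    also have "\<dots> \<le> 2 / real n" using assms by (simp add: field_simps)
    finally show ?thesis .
  qed
  have b: "(cbin (n - m))\<^sup>2 \<le> 1 / real n"
  proof -
    have "(cbin (n - m))\<^sup>2 \<le> 1 / (2 * real (n - m) + 1)"
      using cbin_sq_upper[of "n - m"] by (simp add: field_simps)
    also have "\<dots> \<le> 1 / real n" using assms by (simp add: field_simps)
    finally show ?thesis .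
  qed
  have c: "1 / (cbin n)\<^sup>2 \<le> 4 * real n"
    using cbin_sq_lower[of "n - 1"] cbin_pos[of n] assms by (simp add: field_simps del: cbin.simps)
  have "(lcoef n m)\<^sup>2 = (cbin m)\<^sup>2 * (cbin (n - m))\<^sup>2 * (1 / (cbin n)\<^sup>2)"
    by (simp add: lcoef_def power_mult_distrib power_divide)
  also have "\<dots> \<le> (2 / real n) * (1 / real n) * (4 * real n)"
    using a b c by (intro mult_mono) auto
  also have "\<dots> = 8 / real n" using assms by (simp add: field_simps)
  finally show "(lcoef n m)\<^sup>2 \<le> 8 / real n" .
qed

lemma summation_by_parts:
  fixes d :: "nat \<Rightarrow> real" and z :: complex
  assumes "d 0 = 1"
  shows "(1 - z) * (\<Sum>k\<le>m. of_real (d k) * z ^ k) - (\<Sum>k\<le>m. of_real (cdiff k) * z ^ k)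
    = (\<Sum>k<m. of_real (d (Suc k) - d k - cdiff (Suc k)) * z ^ Suc k) - of_real (d m) * z ^ Suc m"
  by (induction m) (simp_all add: assms algebra_simps del: cdiff.simps(2))

text \<open>
  After summation by parts the coefficients are nonnegative and add up to \<open>d\<^sub>n\<^sub>m - c\<^sub>m\<close>; the boundary term adds
  \<open>d\<^sub>n\<^sub>m\<close> once more. The weight \<open>t\<close> lets one estimate serve both halves: it is \<open>1\<close> for the lower one, where
  \<open>z = u\<close>, and \<open>u ^ n\<close> for the upper one, where \<open>z = 1 / u\<close> may lie outside the unit disc.
\<close>

lemma half_sum:
  fixes z t :: complex
  assumes "m \<le> n" and "\<And>k. k \<le> Suc m \<Longrightarrow> norm (t * z ^ k) \<le> 1"
  shows "norm (t * ((1 - z) * (\<Sum>k\<le>m. of_real (lcoef n k) * z ^ k)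
            - (\<Sum>k\<le>m. of_real (cdiff k) * z ^ k))) \<le> 2 * lcoef n m"
proof -
  define D where "D = (\<lambda>k. lcoef n (Suc k) - lcoef n k - cdiff (Suc k))"
  have D: "0 \<le> D k" if "k < m" for k
    using cdiff_le_lcoef_diff[of k n] that assms(1) by (simp add: D_def del: cdiff.simps)
  have "D k = (lcoef n (Suc k) - cbin (Suc k)) - (lcoef n k - cbin k)" for k
    by (simp add: D_def)
  then have "(\<Sum>k<m. D k) = (lcoef n m - cbin m) - (lcoef n 0 - cbin 0)"
    by (simp only: sum_lessThan_telescope[of "\<lambda>k. lcoef n k - cbin k"])
  then have sumD: "(\<Sum>k<m. D k) \<le> lcoef n m"
    using cbin_pos[of m] by (simp add: lcoef_0)
  have "norm (t * ((\<Sum>k<m. of_real (D k) * z ^ Suc k) - of_real (lcoef n m) * z ^ Suc m))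
      = norm ((\<Sum>k<m. of_real (D k) * (t * z ^ Suc k)) - of_real (lcoef n m) * (t * z ^ Suc m))"
    by (simp add: right_diff_distrib sum_distrib_left mult_ac)
  also have "\<dots> \<le> norm (\<Sum>k<m. of_real (D k) * (t * z ^ Suc k)) + norm (of_real (lcoef n m) * (t * z ^ Suc m))"
    by (rule norm_triangle_ineq4)
  also have "\<dots> \<le> (\<Sum>k<m. D k) + lcoef n m"
  proof (intro add_mono sum_norm_le)
    fix k assume "k \<in> {..<m}"
    then show "norm (of_real (D k) * (t * z ^ Suc k)) \<le> D k"
      using D[of k] assms(2)[of "Suc k"] by (simp add: norm_mult mult_left_le)
  next
    show "norm (of_real (lcoef n m) * (t * z ^ Suc m)) \<le> lcoef n m"
      using lcoef_pos[of n m] assms(2)[of "Suc m"] by (simp add: norm_mult mult_left_le)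
  qed
  also have "\<dots> \<le> 2 * lcoef n m" using sumD by simp
  finally show ?thesis
    unfolding summation_by_parts[of "lcoef n", OF lcoef_0] D_def .
qed

section \<open>The uniform limit\<close>

text \<open>
  The upper half is written backwards, using the symmetry of the coefficients.
\<close>

lemma legQ_split:
  assumes "n \<ge> 1" "u \<noteq> 0"
  shows "legQ n u = (\<Sum>k\<le>n div 2. of_real (lcoef n k) * u ^ k)
    + u ^ n * (\<Sum>k\<le>(n - 1) div 2. of_real (lcoef n k) * (1 / u) ^ k)"
proof -
  have "{..n} = {..n div 2} \<union> (\<lambda>k. n - k) ` {..(n - 1) div 2}"
  proof (intro equalityI subsetI)
    fix k assume "k \<in> {..n}"
    then have "k \<le> n div 2 \<or> (n - k \<le> (n - 1) div 2 \<and> k = n - (n - k))" by auto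
    then show "k \<in> {..n div 2} \<union> (\<lambda>k. n - k) ` {..(n - 1) div 2}" by blast
  qed auto
  moreover have "{..n div 2} \<inter> (\<lambda>k. n - k) ` {..(n - 1) div 2} = {}"
    using assms by auto
  moreover have "inj_on (\<lambda>k. n - k) {..(n - 1) div 2}"
    by (rule inj_onI) auto
  ultimately have "legQ n u = (\<Sum>k\<le>n div 2. of_real (lcoef n k) * u ^ k)
    + (\<Sum>k\<le>(n - 1) div 2. of_real (lcoef n (n - k)) * u ^ (n - k))"
    unfolding legQ_def by (simp add: sum.union_disjoint sum.reindex)
  also have "(\<Sum>k\<le>(n - 1) div 2. of_real (lcoef n (n - k)) * u ^ (n - k))
    = u ^ n * (\<Sum>k\<le>(n - 1) div 2. of_real (lcoef n k) * (1 / u) ^ k)"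
    unfolding sum_distrib_left
    by (intro sum.cong) (use assms in \<open>auto simp: lcoef_sym power_diff power_one_over\<close>)
  finally show ?thesis .
qed

lemma cone_compact:
  "compact {v::complex. 1 \<le> norm v \<and> norm v \<le> R \<and> Re v \<le> \<kappa> * norm v}"
proof -
  have "closed {v::complex. 1 \<le> norm v \<and> norm v \<le> R \<and> Re v \<le> \<kappa> * norm v}"
    by (intro closed_Collect_conj closed_Collect_le continuous_intros)
  moreover have "bounded {v::complex. 1 \<le> norm v \<and> norm v \<le> R \<and> Re v \<le> \<kappa> * norm v}"
    by (rule boundedI) auto
  ultimately show ?thesis by (simp add: compact_eq_bounded_closed)
qed

text \<open>
  This gives the smallness of \<open>u ^ n * h (1 / u)\<close>, which is what remains of the upper half. Close to the unit circle
  \<open>h\<close> is at most \<open>2 c\<close> by uniform continuity along the ray through \<open>v\<close>; away from it \<open>norm v ^ n\<close> grows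
  exponentially and beats the bound of \<open>h\<close>. The cone condition is invariant under scaling, so the ray
  stays inside the region.
\<close>

lemma radial_bound:
  fixes h :: "complex \<Rightarrow> complex" and R \<kappa> c :: real
  defines "V \<equiv> {v. 1 \<le> norm v \<and> norm v \<le> R \<and> Re v \<le> \<kappa> * norm v}"
  assumes cont: "continuous_on V h" and c: "0 < c"
    and unit: "\<And>v. v \<in> V \<Longrightarrow> norm v = 1 \<Longrightarrow> norm (h v) \<le> c"
  shows "\<forall>\<^sub>F n in sequentially. \<forall>v\<in>V. norm (h v) \<le> 2 * c * norm v ^ n"
proof -
  have comp: "compact V" unfolding V_def by (rule cone_compact)
  from compact_uniformly_continuous[OF cont comp] c obtain \<eta> where "0 < \<eta>"
    and \<eta>: "\<And>v w. v \<in> V \<Longrightarrow> w \<in> V \<Longrightarrow> dist w v < \<eta> \<Longrightarrow> dist (h w) (h v) < c"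
    unfolding uniformly_continuous_on_def by metis
  from compact_imp_bounded[OF compact_continuous_image[OF cont comp]]
  obtain M where M: "\<And>v. v \<in> V \<Longrightarrow> norm (h v) \<le> M" by (auto simp: bounded_iff)
  obtain N where N: "M / (2 * c) < (1 + \<eta>) ^ N"
    using real_arch_pow[of "1 + \<eta>" "M / (2 * c)"] \<open>0 < \<eta>\<close> by auto
  have "M / (2 * c) \<le> (1 + \<eta>) ^ n" if "N \<le> n" for n
    using N power_increasing[OF that, of "1 + \<eta>"] \<open>0 < \<eta>\<close> by linarith
  then have "\<forall>\<^sub>F n in sequentially. M / (2 * c) \<le> (1 + \<eta>) ^ n"
    by (auto simp: eventually_sequentially)
  then show ?thesis
  proof eventually_elim
    case (elim n)
    show ?case
    proof
      fix v assume v: "v \<in> V"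
      then have v1: "1 \<le> norm v" by (simp add: V_def)
      show "norm (h v) \<le> 2 * c * norm v ^ n"
      proof (cases "norm v < 1 + \<eta>")
        case True
        define w where "w = v / of_real (norm v)"
        have w: "norm w = 1" "w \<in> V"
          using v v1 order_trans[of 1 "norm v" R]
          by (auto simp: w_def V_def norm_divide divide_simps)
        have "v \<noteq> 0" using v1 by auto
        then have "w - v = of_real (1 - norm v) * w" by (simp add: w_def field_simps)
        then have "dist w v = \<bar>1 - norm v\<bar> * norm w"
          by (metis dist_norm norm_mult norm_of_real)
        then have "dist w v < \<eta>" using True v1 w by simp
        then have "norm (h v) \<le> c + norm (h w)"
          using \<eta>[OF v w(2)] norm_triangle_sub[of "h v" "h w"] by (simp add: dist_norm norm_minus_commute)
        also have "\<dots> \<le> 2 * c * 1" using unit[OF w(2) w(1)] by simp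
        also have "\<dots> \<le> 2 * c * norm v ^ n" using v1 c by (intro mult_left_mono) auto
        finally show ?thesis .
      next
        case False
        have "norm (h v) \<le> 2 * c * (M / (2 * c))" using M[OF v] c by simp
        also have "\<dots> \<le> 2 * c * (1 + \<eta>) ^ n" using elim c by (intro mult_left_mono) auto
        also have "\<dots> \<le> 2 * c * norm v ^ n"
          using False c \<open>0 < \<eta>\<close> by (intro mult_left_mono power_mono) auto
        finally show ?thesis .
      qed
    qed
  qed
qed

text \<open>
  The cone avoids the positive real axis, which contains the branch cut of \<open>csqrt (1 - v)\<close>.
\<close>

lemma one_minus_cone:
  assumes "Re v \<le> \<kappa> * norm v" "\<kappa> < 1" "v \<noteq> 0"
  shows "1 - v \<notin> \<real>\<^sub>\<le>\<^sub>0"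
proof
  assume "1 - v \<in> \<real>\<^sub>\<le>\<^sub>0"
  then have "Im v = 0" "1 \<le> Re v" by (auto simp: complex_nonpos_Reals_iff)
  then have "Re v = norm v" by (simp add: cmod_def)
  then have "norm v * 1 \<le> norm v * \<kappa>" using assms by (simp add: mult.commute)
  then show False using assms by simp
qed

text \<open>
  The two halves, divided by \<open>1 - u\<close> and \<open>1 - 1 / u\<close>; both are at least \<open>1 - \<kappa>\<close> in absolute value. The
  series for \<open>csqrt (1 - 1 / u)\<close> is cut at a fixed index \<open>J\<close>: the terms beyond \<open>J\<close> are bounded by the tail
  \<open>c\<^sub>J\<close> because of the weight \<open>u ^ n\<close>, and the hypothesis on the part up to \<open>J\<close> is to be supplied by
  \<open>radial_bound\<close>.
\<close>

lemma legQ_estimate: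
  fixes u :: complex
  assumes n: "n \<ge> 1" and J: "J \<le> (n - 1) div 2"
    and \<kappa>: "0 \<le> \<kappa>" "\<kappa> < 1"
    and u: "u \<noteq> 0" "norm u \<le> 1" "Re u \<le> \<kappa> * norm u"
    and h: "norm (u ^ n * ((\<Sum>k\<le>J. of_real (cdiff k) * (1 / u) ^ k) - csqrt (1 - 1 / u))) \<le> 2 * cbin J"
  shows "norm (legQ n u - u ^ n / csqrt (1 - 1 / u) - 1 / csqrt (1 - u))
    \<le> (4 * sqrt (8 / real n) + 4 * cbin J) / (1 - \<kappa>)"
proof -
  define v where "v = 1 / u"
  define m1 m2 where "m1 = n div 2" and "m2 = (n - 1) div 2"
  define X Y where "X = (\<Sum>k\<le>m1. complex_of_real (lcoef n k) * u ^ k)"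
    and "Y = (\<Sum>k\<le>m2. complex_of_real (lcoef n k) * v ^ k)"
  define P where "P = (\<lambda>m z. \<Sum>k\<le>m. complex_of_real (cdiff k) * z ^ k)"
  have mid: "lcoef n m1 \<le> sqrt (8 / real n)" "lcoef n m2 \<le> sqrt (8 / real n)"
    using n by (auto simp: m1_def m2_def intro!: lcoef_middle)
  have JM: "J \<le> m1" "J \<le> m2" using J by (auto simp: m1_def m2_def)
  have gap_u: "1 - \<kappa> \<le> norm (1 - u)"
  proof -
    have "Re u \<le> \<kappa>" using u \<kappa> mult_left_le[of "norm u" \<kappa>] by linarith
    then show ?thesis using complex_Re_le_cmod[of "1 - u"] by simp
  qed
  have gap_v: "1 - \<kappa> \<le> norm (1 - v)"
  proof -
    have "norm (1 - v) = norm (1 - u) / norm u"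
      using u by (simp add: v_def norm_divide[symmetric] diff_divide_distrib norm_minus_commute)
    also have "\<dots> \<ge> norm (1 - u)" using u by (simp add: field_simps mult_left_le_one_le)
    finally show ?thesis using gap_u by linarith
  qed
  have nz: "1 - u \<noteq> 0" "1 - v \<noteq> 0" using gap_u gap_v \<kappa> by auto
  have div: "t * z - t / csqrt y = (t * (y * z - csqrt y)) / y" if "y \<noteq> 0" for t y z :: complex
    using that power2_csqrt[of y] by (simp add: field_simps power2_eq_square)
  have A: "norm ((1 - u) * X - csqrt (1 - u)) \<le> 2 * sqrt (8 / real n) + cbin J"
  proof -
    have "norm (1 * ((1 - u) * X - P m1 u)) \<le> 2 * lcoef n m1"
      unfolding X_def P_def using u by (intro half_sum) (auto simp: m1_def norm_power power_le_one)
    moreover have "norm (P m1 u - csqrt (1 - u)) \<le> cbin m1"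
      unfolding P_def using u nz by (intro cdiff_remainder) auto
    moreover have "cbin m1 \<le> cbin J"
      using JM(1) by (rule cbin_antimono)
    ultimately show ?thesis
      using mid norm_triangle_ineq[of "(1 - u) * X - P m1 u" "P m1 u - csqrt (1 - u)"] by simp
  qed
  have B: "norm (u ^ n * ((1 - v) * Y - csqrt (1 - v))) \<le> 2 * sqrt (8 / real n) + 3 * cbin J"
  proof -
    have t: "norm (u ^ n * v ^ k) \<le> 1" if "k \<le> n" for k
    proof -
      have "u ^ n * v ^ k = u ^ (n - k)"
        using that u by (simp add: v_def power_one_over power_diff)
      then show ?thesis using u by (simp add: norm_power power_le_one)
    qed
    have a: "norm (u ^ n * ((1 - v) * Y - P m2 v)) \<le> 2 * lcoef n m2"
      unfolding Y_def P_def using n by (intro half_sum t) (auto simp: m2_def)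
    have "{..m2} = {..J} \<union> {J<..m2}" using JM by auto
    then have "P m2 v - P J v = (\<Sum>k\<in>{J<..m2}. of_real (cdiff k) * v ^ k)"
      unfolding P_def by (simp only: ) (subst sum.union_disjoint, auto)
    then have "norm (u ^ n * (P m2 v - P J v)) = norm (\<Sum>k\<in>{J<..m2}. of_real (cdiff k) * (u ^ n * v ^ k))"
      by (simp add: sum_distrib_left mult_ac)
    also have "\<dots> \<le> (\<Sum>k\<in>{J<..m2}. \<bar>cdiff k\<bar>)"
    proof (rule sum_norm_le)
      fix k assume "k \<in> {J<..m2}"
      then have "k \<le> n" by (auto simp: m2_def)
      from t[OF this] show "norm (of_real (cdiff k) * (u ^ n * v ^ k)) \<le> \<bar>cdiff k\<bar>"
        by (simp add: norm_mult[of "of_real _"] mult_left_le)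
    qed
    also have "\<dots> \<le> cbin J" using sum_abs_cdiff[OF JM(2)] cbin_pos[of m2] by simp
    finally have b: "norm (u ^ n * (P m2 v - P J v)) \<le> cbin J" .
    have c: "norm (u ^ n * (P J v - csqrt (1 - v))) \<le> 2 * cbin J"
      using h by (simp add: P_def v_def)
    have "norm (u ^ n * ((1 - v) * Y - csqrt (1 - v))) = norm (u ^ n * ((1 - v) * Y - P m2 v)
        + u ^ n * (P m2 v - P J v) + u ^ n * (P J v - csqrt (1 - v)))"
      by (simp add: algebra_simps)
    also have "\<dots> \<le> norm (u ^ n * ((1 - v) * Y - P m2 v)) + norm (u ^ n * (P m2 v - P J v))
        + norm (u ^ n * (P J v - csqrt (1 - v)))"
      by (intro order_trans[OF norm_triangle_ineq] add_right_mono norm_triangle_ineq)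
    finally show ?thesis using a b c mid by linarith
  qed
  have "legQ n u - u ^ n / csqrt (1 - v) - 1 / csqrt (1 - u)
      = (1 * X - 1 / csqrt (1 - u)) + (u ^ n * Y - u ^ n / csqrt (1 - v))"
    using legQ_split[OF n u(1)] by (simp add: X_def Y_def v_def m1_def m2_def)
  also have "\<dots> = ((1 - u) * X - csqrt (1 - u)) / (1 - u) + (u ^ n * ((1 - v) * Y - csqrt (1 - v))) / (1 - v)"
    unfolding div[OF nz(1)] div[OF nz(2)] by simp
  finally have "norm (legQ n u - u ^ n / csqrt (1 - v) - 1 / csqrt (1 - u))
    \<le> norm ((1 - u) * X - csqrt (1 - u)) / norm (1 - u) + norm (u ^ n * ((1 - v) * Y - csqrt (1 - v))) / norm (1 - v)"
    by (metis norm_divide norm_triangle_ineq)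
  also have "\<dots> \<le> (2 * sqrt (8 / real n) + cbin J) / (1 - \<kappa>) + (2 * sqrt (8 / real n) + 3 * cbin J) / (1 - \<kappa>)"
    using A B gap_u gap_v \<kappa> cbin_pos[of J] by (intro add_mono frac_le) auto
  also have "\<dots> = (4 * sqrt (8 / real n) + 4 * cbin J) / (1 - \<kappa>)"
    by (simp add: add_divide_distrib[symmetric])
  finally show ?thesis by (simp add: v_def)
qed

text \<open>
  First \<open>J\<close> is chosen to make \<open>c\<^sub>J\<close> small, then \<open>n\<close> large depending on \<open>J\<close>.
\<close>

lemma legQ_uniform_limit:
  fixes r \<kappa> :: real
  assumes r: "0 < r" and \<kappa>: "0 \<le> \<kappa>" "\<kappa> < 1"
  shows "uniform_limit {u. r \<le> norm u \<and> norm u \<le> 1 \<and> Re u \<le> \<kappa> * norm u}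
    (\<lambda>n u. legQ n u - u ^ n / csqrt (1 - 1 / u)) (\<lambda>u. 1 / csqrt (1 - u)) sequentially"
proof (rule uniform_limitI)
  fix e :: real assume e: "0 < e"
  define V where "V = {v::complex. 1 \<le> norm v \<and> norm v \<le> 1 / r \<and> Re v \<le> \<kappa> * norm v}"
  have "(\<lambda>J. 4 * cbin J / (1 - \<kappa>)) \<longlonglongrightarrow> 4 * 0 / (1 - \<kappa>)"
    using \<kappa> by (intro tendsto_intros cbin_tendsto_0) simp
  from order_tendstoD(2)[OF this, of "e / 2"] e have "\<forall>\<^sub>F J in sequentially. 4 * cbin J / (1 - \<kappa>) < e / 2" by simp
  then obtain J where J: "4 * cbin J / (1 - \<kappa>) < e / 2"
    by (auto simp: eventually_sequentially)
  define h where "h = (\<lambda>v. (\<Sum>k\<le>J. of_real (cdiff k) * v ^ k) - csqrt (1 - v))"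
  have V: "1 - v \<notin> \<real>\<^sub>\<le>\<^sub>0" if "v \<in> V" for v
    using that \<kappa> by (intro one_minus_cone[of _ \<kappa>]) (auto simp: V_def)
  have "continuous_on V h"
    unfolding h_def using V
    by (intro continuous_intros continuous_at_imp_continuous_on ballI isCont_csqrt') auto
  then have "\<forall>\<^sub>F n in sequentially. \<forall>v\<in>V. norm (h v) \<le> 2 * cbin J * norm v ^ n"
    unfolding V_def
  proof (rule radial_bound)
    fix v assume v: "v \<in> {v. 1 \<le> norm v \<and> norm v \<le> 1 / r \<and> Re v \<le> \<kappa> * norm v}" "norm v = 1"
    then have "v \<noteq> 1" using \<kappa> by auto
    then show "norm (h v) \<le> cbin J" unfolding h_def using v by (intro cdiff_remainder) auto
  qed (rule cbin_pos)
  moreover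
  have "(\<lambda>n. 4 * sqrt (8 / real n) / (1 - \<kappa>)) \<longlonglongrightarrow> 4 * sqrt 0 / (1 - \<kappa>)"
    using \<kappa> by (intro tendsto_intros lim_const_over_n) simp
  from order_tendstoD(2)[OF this, of "e / 2"] e have "\<forall>\<^sub>F n in sequentially. 4 * sqrt (8 / real n) / (1 - \<kappa>) < e / 2" by simp
  moreover have "\<forall>\<^sub>F n in sequentially. n \<ge> 2 * J + 1" by (rule eventually_ge_at_top)
  ultimately show "\<forall>\<^sub>F n in sequentially.
      \<forall>u\<in>{u. r \<le> norm u \<and> norm u \<le> 1 \<and> Re u \<le> \<kappa> * norm u}.
        dist (legQ n u - u ^ n / csqrt (1 - 1 / u)) (1 / csqrt (1 - u)) < e"
  proof eventually_elim
    case (elim n)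
    show ?case
    proof
      fix u assume u: "u \<in> {u. r \<le> norm u \<and> norm u \<le> 1 \<and> Re u \<le> \<kappa> * norm u}"
      then have u0: "0 < norm u" using r by auto
      have "Re (1 / u) = Re u / (norm u)\<^sup>2" by (simp add: Re_divide cmod_power2)
      also have "\<dots> \<le> \<kappa> * norm u / (norm u)\<^sup>2" using u by (intro divide_right_mono) auto
      also have "\<dots> = \<kappa> * norm (1 / u)" using u0 by (simp add: norm_divide power2_eq_square)
      finally have "1 / u \<in> V" using u u0 r by (auto simp: V_def norm_divide field_simps)
      then have "norm u ^ n * norm (h (1 / u)) \<le> norm u ^ n * (2 * cbin J * norm (1 / u) ^ n)"
        using elim(1) by (intro mult_left_mono) auto
      also have "\<dots> = 2 * cbin J" using u0 by (simp add: norm_divide power_one_over)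
      finally have "norm (u ^ n * h (1 / u)) \<le> 2 * cbin J" by (simp add: norm_mult norm_power)
      then have "norm (legQ n u - u ^ n / csqrt (1 - 1 / u) - 1 / csqrt (1 - u))
          \<le> (4 * sqrt (8 / real n) + 4 * cbin J) / (1 - \<kappa>)"
        using elim u u0 \<kappa> unfolding h_def by (intro legQ_estimate) auto
      also have "\<dots> < e" using J elim(2) by (simp add: add_divide_distrib)
      finally show "dist (legQ n u - u ^ n / csqrt (1 - 1 / u)) (1 / csqrt (1 - u)) < e"
        by (simp add: dist_norm)
    qed
  qed
qed

section \<open>The amplitudes\<close>

text \<open>
  Both sides have the same square, so only the branch is at stake. The left side is \<open>2 E / s\<close> with
  \<open>E = exp (\<i> (\<pi>/4 - \<theta>/2)) / sqrt 2\<close> and \<open>s = csqrt (sin \<theta>)\<close>. On the strip both \<open>E\<close> and \<open>s\<close> have arguments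
  strictly between \<open>-\<pi>/4\<close> and \<open>\<pi>/4\<close>, so the quotient has positive real part and is the principal root.
\<close>

lemma amplitude_combination:
  fixes \<theta> :: complex
  assumes "0 < Re \<theta>" "Re \<theta> < pi"
  shows "(cos (\<theta> / 2) + sin (\<theta> / 2)) / csqrt (sin \<theta>) + \<i> * ((cos (\<theta> / 2) - sin (\<theta> / 2)) / csqrt (sin \<theta>))
    = 2 / csqrt (1 - exp (2 * \<i> * \<theta>))"
proof -
  define s where "s = csqrt (sin \<theta>)"
  have "0 < sin (Re \<theta>) * (exp (Im \<theta>) + exp (- Im \<theta>)) / 2"
    using assms by (intro divide_pos_pos mult_pos_pos sin_gt_zero add_pos_pos) auto
  then have "0 < Re (sin \<theta>)" by (simp add: Re_sin)
  then have "0 < Re (s\<^sup>2)" by (simp add: s_def)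
  then have "(Im s)\<^sup>2 < (Re s)\<^sup>2" by (simp only: Re_power2)
  moreover have "0 \<le> Re s" unfolding s_def using csqrt_principal[of "sin \<theta>"] by auto
  ultimately have s: "\<bar>Im s\<bar> < Re s" using power2_less_imp_less[of "\<bar>Im s\<bar>" "Re s"] by simp
  define E where "E = (1 + \<i>) / 2 * exp (- (\<i> * \<theta> / 2))"
  define b where "b = Re \<theta> / 2"
  have sc: "0 < sin b" "0 < cos b" using assms by (auto simp: b_def intro!: sin_gt_zero cos_gt_zero)
  define q where "q = exp (Im \<theta> / 2) / 2"
  have "0 < q" by (simp add: q_def)
  have RI: "Re E = q * (cos b + sin b)" "Im E = q * (cos b - sin b)"
    by (simp_all add: E_def b_def q_def Re_exp Im_exp field_simps)
  have "q * \<bar>cos b - sin b\<bar> < q * (cos b + sin b)"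
    using sc \<open>0 < q\<close> by (intro mult_strict_left_mono) auto
  then have E: "\<bar>Im E\<bar> < Re E" using \<open>0 < q\<close> by (simp add: RI abs_mult)
  have nz: "E \<noteq> 0" "s \<noteq> 0" using E s by auto
  have "Re (s / E) > 0"
  proof -
    have "\<bar>Im s * Im E\<bar> < Re s * Re E" unfolding abs_mult using s E by (intro mult_strict_mono) auto
    then have "0 < Re s * Re E + Im s * Im E" by linarith
    then show ?thesis using nz by (simp add: Re_divide complex_neq_0)
  qed
  moreover have "(s / E)\<^sup>2 = 1 - exp (2 * \<i> * \<theta>)"
  proof -
    define y where "y = exp (\<i> * \<theta> / 2)"
    have y1: "exp (\<i> * \<theta>) = y\<^sup>2" "y \<noteq> 0" by (simp_all add: y_def exp_double[symmetric])
    then have "exp (2 * \<i> * \<theta>) = y ^ 4" using exp_double[of "\<i> * \<theta>"] by (simp add: mult.assoc)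
    note y = y1 this
    have "E = (1 + \<i>) / (2 * y)" by (simp add: E_def y_def exp_minus field_simps)
    then have "E\<^sup>2 = \<i> / (2 * y\<^sup>2)"
      by (simp add: power_divide power_mult_distrib) (simp add: power2_eq_square algebra_simps)
    moreover have "s\<^sup>2 = (y\<^sup>2 - 1 / y\<^sup>2) / (2 * \<i>)"
      by (simp add: s_def sin_exp_eq exp_minus y inverse_eq_divide)
    ultimately have "(s / E)\<^sup>2 = 1 - (y\<^sup>2)\<^sup>2"
      using y1(2) by (simp add: power_divide) (simp add: field_simps power2_eq_square power4_eq_xxxx)
    then show ?thesis using y by simp
  qed
  ultimately have C: "csqrt (1 - exp (2 * \<i> * \<theta>)) = s / E"
    by (intro csqrt_unique) auto
  have D: "cos (\<theta> / 2) + sin (\<theta> / 2) + \<i> * (cos (\<theta> / 2) - sin (\<theta> / 2)) = 2 * E"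
  proof -
    have ex: "exp (- (\<i> * \<theta> / 2)) = cos (\<theta> / 2) - \<i> * sin (\<theta> / 2)"
      using exp_Euler[of "- (\<theta> / 2)"] by simp
    show ?thesis unfolding E_def ex by (simp add: field_simps)
  qed
  have "(cos (\<theta> / 2) + sin (\<theta> / 2)) / s + \<i> * ((cos (\<theta> / 2) - sin (\<theta> / 2)) / s) = 2 * E / s"
    unfolding D[symmetric] by (simp add: add_divide_distrib)
  also have "\<dots> = 2 / (s / E)" by simp
  finally show ?thesis unfolding C s_def .
qed

lemma amp_plus:
  assumes "0 < Re (Arccos x)" "Re (Arccos x) < pi"
  shows "amp_cos x + \<i> * amp_sin x = 2 / csqrt (1 - exp (2 * \<i> * Arccos x))"
  using amplitude_combination[OF assms] by (simp add: amp_cos_def amp_sin_def)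

text \<open>
  The reflection \<open>\<theta> \<mapsto> \<pi> - \<theta>\<close> exchanges sine and cosine of the half angle and turns \<open>exp (2 \<i> \<theta>)\<close> into
  \<open>exp (- 2 \<i> \<theta>)\<close>.
\<close>

lemma amp_minus:
  assumes "0 < Re (Arccos x)" "Re (Arccos x) < pi"
  shows "amp_cos x - \<i> * amp_sin x = 2 / csqrt (1 - exp (- (2 * \<i> * Arccos x)))"
proof -
  let ?t = "complex_of_real pi - Arccos x"
  have half: "?t / 2 = complex_of_real pi / 2 - Arccos x / 2" by (simp add: diff_divide_distrib)
  have "cos (?t / 2) = sin (Arccos x / 2)" "sin (?t / 2) = cos (Arccos x / 2)"
    unfolding half by (simp_all add: cos_diff sin_diff)
  moreover have "sin ?t = sin (Arccos x)" by (simp add: sin_diff)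
  moreover have "exp (2 * \<i> * ?t) = exp (- (2 * \<i> * Arccos x))"
    by (simp add: algebra_simps exp_diff exp_minus inverse_eq_divide)
  moreover have "0 < Re ?t" "Re ?t < pi" using assms by auto
  ultimately show ?thesis
    using amplitude_combination[of ?t] by (simp add: amp_cos_def amp_sin_def algebra_simps diff_divide_distrib)
qed

section \<open>The asymptotic expansion\<close>

definition legErr :: "nat \<Rightarrow> complex \<Rightarrow> complex" where
  "legErr n u = legQ n u - u ^ n / csqrt (1 - 1 / u) - 1 / csqrt (1 - u)"

text \<open>
  An exact identity, valid for either sign. The term \<open>legErr\<close> multiplies \<open>w powi (- n)\<close>, which for
  \<open>norm w \<le> 1\<close> is the dominant one of the two exponentials, and \<open>w powi (- n) = cos (n \<theta>) - \<sigma> \<i> sin (n \<theta>)\<close>.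
\<close>

lemma legendre_expansion:
  fixes x \<theta> :: complex and n :: nat
  defines "\<theta> \<equiv> Arccos x"
  assumes re: "0 < Re \<theta>" "Re \<theta> < pi"
    and \<sigma>: "\<sigma> = 1 \<or> \<sigma> = -1"
  defines "\<eta> \<equiv> legErr n (exp (\<sigma> * (2 * \<i> * \<theta>)))"
  shows "poly (monic_legendre n) x = 1 / 2 ^ n *
      ((amp_cos x + \<eta>) * cos (of_nat n * \<theta>) + (amp_sin x + (- \<sigma> * \<i> * \<eta>)) * sin (of_nat n * \<theta>))"
proof -
  define w u where "w = exp (\<sigma> * \<i> * \<theta>)" and "u = exp (\<sigma> * (2 * \<i> * \<theta>))"
  have w: "w \<noteq> 0" by (simp add: w_def)
  have wu: "w\<^sup>2 = u" by (simp add: w_def u_def exp_double[symmetric] mult_ac)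
  have inv: "1 / w = exp (- (\<sigma> * \<i> * \<theta>))" "1 / u = exp (- (\<sigma> * (2 * \<i> * \<theta>)))"
    by (simp_all add: w_def u_def exp_minus inverse_eq_divide)
  have "cos \<theta> = x" by (simp add: \<theta>_def)
  then have x: "2 * x = w + 1 / w"
    unfolding inv unfolding w_def using \<sigma> cos_exp_eq[of \<theta>] by (auto simp: mult_ac add.commute)
  define c s where "c = cos (of_nat n * \<theta>)" and "s = sin (of_nat n * \<theta>)"
  have wn: "w ^ n = c + \<sigma> * \<i> * s" and wn': "(1 / w) ^ n = c - \<sigma> * \<i> * s"
  proof -
    have "w ^ n = exp (\<i> * (\<sigma> * (of_nat n * \<theta>)))"
      unfolding w_def exp_of_nat_mult[symmetric] by (simp add: mult_ac)
    then show "w ^ n = c + \<sigma> * \<i> * s" unfolding exp_Euler using \<sigma> by (auto simp: c_def s_def)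
    have "(1 / w) ^ n = exp (\<i> * (- \<sigma> * (of_nat n * \<theta>)))"
      unfolding inv exp_of_nat_mult[symmetric] by (simp add: mult_ac)
    then show "(1 / w) ^ n = c - \<sigma> * \<i> * s" unfolding exp_Euler using \<sigma> by (auto simp: c_def s_def)
  qed
  have amp: "1 / csqrt (1 - u) = (amp_cos x + \<sigma> * \<i> * amp_sin x) / 2"
    "1 / csqrt (1 - 1 / u) = (amp_cos x - \<sigma> * \<i> * amp_sin x) / 2"
  proof -
    have plus: "1 / csqrt (1 - exp (2 * \<i> * \<theta>)) = (amp_cos x + \<i> * amp_sin x) / 2"
      and minus: "1 / csqrt (1 - exp (- (2 * \<i> * \<theta>))) = (amp_cos x - \<i> * amp_sin x) / 2"
      using amp_plus[of x] amp_minus[of x] re unfolding \<theta>_def by simp_all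
    from \<sigma> show "1 / csqrt (1 - u) = (amp_cos x + \<sigma> * \<i> * amp_sin x) / 2"
      unfolding u_def by (elim disjE) (simp_all only: mult_1 mult_minus1 mult_minus_left plus minus add_uminus_conv_diff)
    from \<sigma> show "1 / csqrt (1 - 1 / u) = (amp_cos x - \<sigma> * \<i> * amp_sin x) / 2"
      unfolding inv by (elim disjE) (simp_all only: mult_1 mult_minus1 mult_minus_left minus_minus plus minus diff_minus_eq_add)
  qed
  have Q: "legQ n u = \<eta> + (amp_cos x + \<sigma> * \<i> * amp_sin x) / 2
      + u ^ n * ((amp_cos x - \<sigma> * \<i> * amp_sin x) / 2)"
    unfolding \<eta>_def legErr_def u_def[symmetric] amp[symmetric] by simp
  have uw: "u ^ n * (1 / w) ^ n = w ^ n"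
    using w by (simp add: wu[symmetric] power2_eq_square power_mult_distrib power_one_over)
  have "2 ^ n * poly (monic_legendre n) x = legQ n u * (1 / w) ^ n"
    using monic_legendre_eq_legQ[OF w x, of n] w by (simp add: wu field_simps)
  also have "\<dots> = (\<eta> + (amp_cos x + \<sigma> * \<i> * amp_sin x) / 2) * (1 / w) ^ n
      + (u ^ n * (1 / w) ^ n) * ((amp_cos x - \<sigma> * \<i> * amp_sin x) / 2)"
    unfolding Q by (simp only: ring_distribs mult_ac)
  also have "\<dots> = (\<eta> + (amp_cos x + \<sigma> * \<i> * amp_sin x) / 2) * (1 / w) ^ n
      + w ^ n * ((amp_cos x - \<sigma> * \<i> * amp_sin x) / 2)"
    unfolding uw ..
  also have "\<dots> = (amp_cos x + \<eta>) * c + (amp_sin x - \<sigma> * \<i> * \<eta>) * s"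
    unfolding wn wn' using \<sigma> by (auto simp: field_simps)
  finally show ?thesis unfolding c_def[symmetric] s_def[symmetric] by (simp add: field_simps)
qed

theorem theorem2p2:
  fixes \<delta> :: real
  assumes "0 < \<delta>" and "\<delta> < 1"
  shows "\<exists>(U :: complex set) (\<epsilon>1 :: nat \<Rightarrow> complex \<Rightarrow> complex) (\<epsilon>2 :: nat \<Rightarrow> complex \<Rightarrow> complex).
    open U \<and> complex_of_real ` {-1 + \<delta> .. 1 - \<delta>} \<subseteq> U \<and>
    Arccos holomorphic_on U \<and> (\<forall>x\<in>U. 0 < Re (Arccos x) \<and> Re (Arccos x) < pi) \<and>
    uniform_limit U \<epsilon>1 (\<lambda>x. 0) sequentially \<and>
    uniform_limit U \<epsilon>2 (\<lambda>x. 0) sequentially \<and>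
    (\<forall>x\<in>U. \<forall>n\<ge>1.
       poly (monic_legendre n) x =
         1 / 2 ^ n *
           ((amp_cos x + \<epsilon>1 n x) * cos (of_nat n * Arccos x)
            + (amp_sin x + \<epsilon>2 n x) * sin (of_nat n * Arccos x)))"
proof -
  define \<alpha> where "\<alpha> = arccos (1 - \<delta>)"
  have \<alpha>: "0 < \<alpha>" "\<alpha> < pi" "cos \<alpha> = 1 - \<delta>"
    using assms arccos_lt_bounded[of "1 - \<delta>"] by (auto simp: \<alpha>_def)
  define V where "V = {\<theta>::complex. \<alpha> / 2 < Re \<theta> \<and> Re \<theta> < pi - \<alpha> / 2 \<and> \<bar>Im \<theta>\<bar> < 1}"
  \<comment> \<open>On \<open>S\<close> the function \<open>Arccos\<close> is holomorphic with values in the open strip of width \<open>pi\<close>.\<close>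
  define S where "S = {x::complex. -1 < Re x \<and> Re x < 1}"
  define U where "U = S \<inter> Arccos -` V"
  have "open V" unfolding V_def by (intro open_Collect_conj open_Collect_less continuous_intros)
  have "open S" unfolding S_def by (intro open_Collect_conj open_Collect_less continuous_intros)
  have hol: "Arccos holomorphic_on S" by (rule holomorphic_on_Arccos) (auto simp: S_def)
  have "open U"
    unfolding U_def using holomorphic_on_imp_continuous_on[OF hol] \<open>open S\<close> \<open>open V\<close>
    by (rule continuous_open_preimage)
  have interval: "complex_of_real ` {-1 + \<delta> .. 1 - \<delta>} \<subseteq> U"
  proof (rule image_subsetI)
    fix t assume t: "t \<in> {-1 + \<delta> .. 1 - \<delta>}"
    have "\<alpha> \<le> arccos t" unfolding \<alpha>_def using t assms by (intro arccos_le_arccos) auto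
    moreover have "arccos t \<le> arccos (- (1 - \<delta>))" using t assms by (intro arccos_le_arccos) auto
    then have "arccos t \<le> pi - \<alpha>" using assms arccos_minus[of "1 - \<delta>"] by (simp add: \<alpha>_def)
    moreover have "Arccos (of_real t) = of_real (arccos t)"
      by (rule of_real_arccos[symmetric]) (use t assms in auto)
    ultimately show "of_real t \<in> U" using t assms \<alpha> by (auto simp: U_def S_def V_def)
  qed
  have re: "0 < Re (Arccos x)" "Re (Arccos x) < pi" if "x \<in> U" for x
    using that Arccos_bounds[of x] by (auto simp: U_def S_def)
  \<comment> \<open>The sign that makes \<open>norm (u x) \<le> 1\<close>; neither it nor the errors are continuous in \<open>x\<close>.\<close>
  define \<sigma> where "\<sigma> = (\<lambda>x. if Im (Arccos x) \<ge> 0 then 1 else -1 :: complex)"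
  define u where "u = (\<lambda>x. exp (\<sigma> x * (2 * \<i> * Arccos x)))"
  define W where "W = {u::complex. exp (-2) \<le> norm u \<and> norm u \<le> 1 \<and> Re u \<le> (1 - \<delta>) * norm u}"
  have uW: "u x \<in> W" if "x \<in> U" for x
  proof -
    define \<theta> where "\<theta> = Arccos x"
    have \<theta>: "\<alpha> / 2 < Re \<theta>" "Re \<theta> < pi - \<alpha> / 2" "\<bar>Im \<theta>\<bar> < 1"
      using that by (auto simp: U_def V_def \<theta>_def)
    have nrm: "norm (u x) = exp (- 2 * \<bar>Im \<theta>\<bar>)"
      by (auto simp: u_def \<sigma>_def \<theta>_def)
    have Re: "Re (u x) = norm (u x) * cos (2 * Re \<theta>)"
      unfolding nrm by (auto simp: u_def \<sigma>_def \<theta>_def Re_exp)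
    \<comment> \<open>The margin \<open>\<alpha> / 2\<close> is chosen so that the aperture of the cone comes out as \<open>1 - \<delta>\<close>.\<close>
    have "cos (2 * Re \<theta>) \<le> 1 - \<delta>"
    proof (cases "2 * Re \<theta> \<le> pi")
      case True
      then show ?thesis using \<theta> \<alpha> cos_monotone_0_pi_le[of \<alpha> "2 * Re \<theta>"] by simp
    next
      case False
      have "cos (2 * Re \<theta>) = cos (2 * pi - 2 * Re \<theta>)" by (simp add: cos_diff)
      then show ?thesis using False \<theta> \<alpha> cos_monotone_0_pi_le[of \<alpha> "2 * pi - 2 * Re \<theta>"] by simp
    qed
    then have "norm (u x) * cos (2 * Re \<theta>) \<le> norm (u x) * (1 - \<delta>)" by (intro mult_left_mono) auto
    then have "Re (u x) \<le> (1 - \<delta>) * norm (u x)" unfolding Re by (simp only: mult.commute)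
    moreover have "exp (-2) \<le> norm (u x)" "norm (u x) \<le> 1" unfolding nrm using \<theta>(3) by auto
    ultimately show ?thesis unfolding W_def by blast
  qed
  have lim: "uniform_limit U (\<lambda>n x. legErr n (u x)) (\<lambda>x. 0) sequentially"
  proof -
    have "uniform_limit W (\<lambda>n u. legQ n u - u ^ n / csqrt (1 - 1 / u)) (\<lambda>u. 1 / csqrt (1 - u)) sequentially"
      unfolding W_def using assms by (intro legQ_uniform_limit) auto
    then have "uniform_limit W legErr (\<lambda>u. 0) sequentially"
      unfolding uniform_limit_iff legErr_def by (simp add: dist_norm)
    then show ?thesis using uW unfolding uniform_limit_iff by (auto elim!: eventually_mono)
  qed
  have lim2: "uniform_limit U (\<lambda>n x. - \<sigma> x * \<i> * legErr n (u x)) (\<lambda>x. 0) sequentially"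
  proof -
    have "dist (- \<sigma> x * \<i> * y) 0 = dist y 0" for x y
      by (simp add: norm_mult \<sigma>_def)
    then show ?thesis using lim unfolding uniform_limit_iff by (simp only:)
  qed
  show ?thesis
  proof (intro exI conjI)
    show "open U" "complex_of_real ` {-1 + \<delta> .. 1 - \<delta>} \<subseteq> U" by fact+
    show "Arccos holomorphic_on U" using hol by (rule holomorphic_on_subset) (simp add: U_def)
    show "\<forall>x\<in>U. 0 < Re (Arccos x) \<and> Re (Arccos x) < pi" using re by simp
    show "\<forall>x\<in>U. \<forall>n\<ge>1. poly (monic_legendre n) x = 1 / 2 ^ n *
        ((amp_cos x + legErr n (u x)) * cos (of_nat n * Arccos x)
          + (amp_sin x + - \<sigma> x * \<i> * legErr n (u x)) * sin (of_nat n * Arccos x))"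
    proof (intro ballI allI impI)
      fix x n assume "x \<in> U"
      have "\<sigma> x = 1 \<or> \<sigma> x = -1" by (simp add: \<sigma>_def)
      then show "poly (monic_legendre n) x = 1 / 2 ^ n *
        ((amp_cos x + legErr n (u x)) * cos (of_nat n * Arccos x)
          + (amp_sin x + - \<sigma> x * \<i> * legErr n (u x)) * sin (of_nat n * Arccos x))"
        unfolding u_def by (rule legendre_expansion[OF re[OF \<open>x \<in> U\<close>]])
    qed
  qed (rule lim lim2)+
qed

end
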